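(* Let $\ell:\mathbb{R}\times\mathbb{R}\to\mathbb{R}$ be smooth with locally Lipschitz gradient, let $\{(x_i,y_i)\}_{i=1}^N\subseteq\mathbb{R}^d\times\mathbb{R}$ with $x_i\ne0$ for all $i$, write $\ell_i(\cdot)=\ell(\cdot,y_i)$, and let $$L(u_1,w_1,\dots,u_H,w_H)=\sum_{i=1}^N\ell_i\Big(\sum_{k=1}^H u_k\max\{w_k^\top x_i,0\}\Big),\qquad u_k\in\mathbb{R},\ w_k\in\mathbb{R}^d.$$ For any given point such that $\widehat\partial L(u_1,w_1,\dots,u_H,w_H)\neq\emptyset$, the exact chain rule $$\widehat\partial L(u_1,w_1,\dots,u_H,w_H)=\prod_{k=1}^H\Big\{\sum_{i=1}^N\rho_i\max\{w_k^\top x_i,0\}\Big\}\times G_k^F$$ holds if and only if the data satisfy the Span Qualification (SQ): $$\bigcup_{1\le k\le H}\Big(\mathrm{span}\big(\{x_i\}_{i\in\mathcal I_k^+}\big)\cap\mathrm{span}\big(\{x_j\}_{j\in\mathcal I_k^-}\big)\Big)=\{0\}.$$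
   Context: At the given point define $\rho_i=\ell_i'\big(\sum_{k=1}^H u_k\max\{w_k^\top x_i,0\}\big)$ for $i\in[N]=\{1,\dots,N\}$, and for $k\in[H]$ $$\mathcal I_k^+=\{i\in[N]: w_k^\top x_i=0,\ u_k\rho_i\ge0\},\qquad \mathcal I_k^-=\{i\in[N]: w_k^\top x_i=0,\ u_k\rho_i<0\},$$ $$G_k^F=\sum_{i\in[N]\setminus(\mathcal I_k^+\cup\mathcal I_k^-)}u_k\rho_i\mathbf 1_{w_k^\top x_i>0}x_i+\sum_{j\in\mathcal I_k^+}u_k\rho_jx_j\cdot[0,1]+\begin{cases}\emptyset&\text{if }|\mathcal I_k^-|>0,\\ \{0\}&\text{if }|\mathcal I_k^-|=0\end{cases}$$ (Minkowski sums; a sum with $\emptyset$ is $\emptyset$). The span of the empty family is $\{0\}$. Fréchet subdifferential of a locally Lipschitz, directionally differentiable $f$: $\widehat\partial f(x)=\{s:s^\top d\le f'(x;d)\text{ for all }d\}$. *)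

theory Defs
  imports "HOL-Analysis.Analysis" "HOL-Library.Set_Algebras"
begin

definition locally_lipschitz :: "('a::metric_space \<Rightarrow> 'b::metric_space) \<Rightarrow> bool" where
  "locally_lipschitz f \<longleftrightarrow> (\<forall>z. \<exists>r>0. \<exists>C. C-lipschitz_on (cball z r) f)"

definition smooth_loclip_gradient :: "('a::real_inner \<Rightarrow> real) \<Rightarrow> bool" where
  "smooth_loclip_gradient f \<longleftrightarrow> (\<exists>g. (\<forall>z. GDERIV f z :> g z) \<and> locally_lipschitz g)"

text \<open>One-sided directional derivative \<open>f'(z; d)\<close>. \<open>Lim\<close> is unspecified if the limit
  does not exist, so this and the next definition are meant for directionally differentiable \<open>f\<close>.\<close>

definition dir_deriv :: "('a::real_normed_vector \<Rightarrow> real) \<Rightarrow> 'a \<Rightarrow> 'a \<Rightarrow> real" where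
  "dir_deriv f z d = Lim (at_right 0) (\<lambda>t. (f (z + t *\<^sub>R d) - f z) / t)"

definition frechet_subdiff :: "('a::real_inner \<Rightarrow> real) \<Rightarrow> 'a \<Rightarrow> 'a set" where
  "frechet_subdiff f z = {s. \<forall>d. s \<bullet> d \<le> dir_deriv f z d}"

text \<open>A point \<open>(u\<^sub>1, w\<^sub>1, \<dots>, u\<^sub>H, w\<^sub>H)\<close> is a vector \<open>p\<close> whose \<open>k\<close>-th entry is the pair
  \<open>(u\<^sub>k, w\<^sub>k)\<close>. The index types \<open>'h\<close> and \<open>'n\<close> stand for \<open>{1..H}\<close> and \<open>{1..N}\<close>.\<close>

definition network :: "(real \<times> (real^'d))^'h \<Rightarrow> real^'d \<Rightarrow> real" where
  "network p v = (\<Sum>k\<in>UNIV. fst (p $ k) * max (snd (p $ k) \<bullet> v) 0)"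

definition loss ::
  "(real \<times> real \<Rightarrow> real) \<Rightarrow> ('n::finite \<Rightarrow> real^'d) \<Rightarrow> ('n \<Rightarrow> real) \<Rightarrow> (real \<times> (real^'d))^'h \<Rightarrow> real"
where
  "loss l x y p = (\<Sum>i\<in>UNIV. l (network p (x i), y i))"

definition rho ::
  "(real \<times> real \<Rightarrow> real) \<Rightarrow> ('n::finite \<Rightarrow> real^'d) \<Rightarrow> ('n \<Rightarrow> real) \<Rightarrow> (real \<times> (real^'d))^'h \<Rightarrow> 'n \<Rightarrow> real"
where
  "rho l x y p i = deriv (\<lambda>a. l (a, y i)) (network p (x i))"

definition I_plus ::
  "(real \<times> real \<Rightarrow> real) \<Rightarrow> ('n::finite \<Rightarrow> real^'d) \<Rightarrow> ('n \<Rightarrow> real) \<Rightarrow> (real \<times> (real^'d))^'h \<Rightarrow> 'h \<Rightarrow> 'n set"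
where
  "I_plus l x y p k = {i. snd (p $ k) \<bullet> x i = 0 \<and> fst (p $ k) * rho l x y p i \<ge> 0}"

definition I_minus ::
  "(real \<times> real \<Rightarrow> real) \<Rightarrow> ('n::finite \<Rightarrow> real^'d) \<Rightarrow> ('n \<Rightarrow> real) \<Rightarrow> (real \<times> (real^'d))^'h \<Rightarrow> 'h \<Rightarrow> 'n set"
where
  "I_minus l x y p k = {i. snd (p $ k) \<bullet> x i = 0 \<and> fst (p $ k) * rho l x y p i < 0}"

text \<open>The outer additions, and the sum over \<open>I_plus\<close>, are Minkowski sums of sets.\<close>

definition G_F ::
  "(real \<times> real \<Rightarrow> real) \<Rightarrow> ('n::finite \<Rightarrow> real^'d) \<Rightarrow> ('n \<Rightarrow> real) \<Rightarrow> (real \<times> (real^'d))^'h \<Rightarrow> 'h \<Rightarrow> (real^'d) set"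
where
  "G_F l x y p k =
     {\<Sum>i \<in> UNIV - (I_plus l x y p k \<union> I_minus l x y p k).
        (fst (p $ k) * rho l x y p i * of_bool (snd (p $ k) \<bullet> x i > 0)) *\<^sub>R x i}
     + (\<Sum>j \<in> I_plus l x y p k. (\<lambda>t. t *\<^sub>R (fst (p $ k) * rho l x y p j) *\<^sub>R x j) ` {0..1})
     + (if card (I_minus l x y p k) > 0 then {} else {0})"

definition span_qualification ::
  "(real \<times> real \<Rightarrow> real) \<Rightarrow> ('n::finite \<Rightarrow> real^'d) \<Rightarrow> ('n \<Rightarrow> real) \<Rightarrow> (real \<times> (real^'d))^'h \<Rightarrow> bool"
where
  "span_qualification l x y p \<longleftrightarrow>
     (\<Union>k. span (x ` I_plus l x y p k) \<inter> span (x ` I_minus l x y p k)) = {0}"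

end

theory Submission
  imports Defs
begin

text \<open>
  Both sides of the equivalence say that no hidden unit has a \<^emph>\<open>negative kink\<close>: every set
  \<open>I_minus\<close> is empty.

  The directional derivative of the loss is a sum over the units \<open>k\<close>, and in unit \<open>k\<close> it is
  linear in the perturbation of \<open>u\<^sub>k\<close> and equal to a positively homogeneous function of the
  perturbation \<open>v\<close> of \<open>w\<^sub>k\<close> (\<open>dir_deriv_loss\<close>). Hence the subdifferential is always a product
  over the units of a point and the set of vectors \<open>g\<close> whose inner product with \<open>v\<close> stays below
  that function (\<open>frechet_subdiff_loss_iff\<close>). Up to a linear term the function is
  \<open>\<Sum>j. b\<^sub>j * max (v \<bullet> x\<^sub>j) 0\<close>, summed over the data on the kink of unit \<open>k\<close>, with
  \<open>b\<^sub>j = u\<^sub>k * \<rho>\<^sub>j\<close>.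

  If no \<open>b\<^sub>j\<close> is negative, this is the support function of a zonotope, and separation of a point
  from a compact convex set identifies the minorants with \<open>G_F\<close> (\<open>mem_zonotope_iff\<close>). So the chain
  rule holds when all sets \<open>I_minus\<close> are empty. If some \<open>I_minus\<close> is nonempty, then \<open>G_F\<close> is
  empty for that unit while the subdifferential is not, and the chain rule fails.

  The span qualification trivially holds when all sets \<open>I_minus\<close> are empty. Conversely, take
  \<open>j\<close> in \<open>I_minus\<close> with \<open>x\<^sub>j\<close> outside the span of the positive kinks. Then some direction \<open>v\<close> is
  orthogonal to all positive kinks but not to \<open>x\<^sub>j\<close>. Along this line the loss has a strictly
  concave kink, which excludes any subgradient. A nonempty subdifferential therefore places every
  negative kink \<open>x\<^sub>j\<close> in both spans (\<open>I_minus_in_span_I_plus_if_slope_minorized\<close>), and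
  \<open>x\<^sub>j \<noteq> 0\<close> violates the qualification.
\<close>

section \<open>The directional derivative of the loss\<close>

text \<open>The one-sided derivative of \<open>\<lambda>a. max a 0\<close> at \<open>a\<close> in direction \<open>b\<close>.\<close>

definition relu_slope :: "real \<Rightarrow> real \<Rightarrow> real" where
  "relu_slope a b = (if a > 0 then b else if a = 0 then max b 0 else 0)"

lemma relu_slope_0 [simp]: "relu_slope a 0 = 0"
  by (simp add: relu_slope_def)

lemma relu_has_right_derivative:
  "((\<lambda>t. max (a + t * b) 0) has_real_derivative relu_slope a b) (at_right 0)"
proof -
  have lin: "((\<lambda>t. a + t * b) has_real_derivative b) (at_right 0)"
    by (auto intro!: derivative_eq_intros)
  have lim: "((\<lambda>t. a + t * b) \<longlongrightarrow> a) (at_right 0)"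
    by (auto intro!: tendsto_eq_intros)
  consider "a > 0" | "a < 0" | "a = 0" "b \<ge> 0" | "a = 0" "b < 0" by linarith
  then show ?thesis
  proof cases
    case 1
    have ev: "\<forall>\<^sub>F t in at_right 0. a + t * b = max (a + t * b) 0"
      using order_tendstoD(1)[OF lim 1] by eventually_elim simp
    have "((\<lambda>t. max (a + t * b) 0) has_real_derivative b) (at_right 0)"
      by (rule iffD1[OF has_field_derivative_cong_eventually[OF ev] lin]) (use 1 in simp)
    then show ?thesis using 1 by (simp add: relu_slope_def)
  next
    case 2
    have ev: "\<forall>\<^sub>F t in at_right 0. 0 = max (a + t * b) 0"
      using order_tendstoD(2)[OF lim 2] by eventually_elim simp
    have "((\<lambda>t. max (a + t * b) 0) has_real_derivative 0) (at_right 0)"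
      by (rule iffD1[OF has_field_derivative_cong_eventually[OF ev]]) (use 2 in auto)
    then show ?thesis using 2 by (simp add: relu_slope_def)
  next
    case 3
    have ev: "\<forall>\<^sub>F t in at_right 0. a + t * b = max (a + t * b) 0"
      using eventually_at_right_less[of 0] by eventually_elim (use 3 in simp)
    have "((\<lambda>t. max (a + t * b) 0) has_real_derivative b) (at_right 0)"
      by (rule iffD1[OF has_field_derivative_cong_eventually[OF ev] lin]) (use 3 in simp)
    then show ?thesis using 3 by (simp add: relu_slope_def)
  next
    case 4
    have ev: "\<forall>\<^sub>F t in at_right 0. 0 = max (a + t * b) 0"
      using eventually_at_right_less[of 0] by eventually_elim (use 4 in \<open>simp add: mult_nonneg_nonpos\<close>)
    have "((\<lambda>t. max (a + t * b) 0) has_real_derivative 0) (at_right 0)"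
      by (rule iffD1[OF has_field_derivative_cong_eventually[OF ev]]) (use 4 in auto)
    then show ?thesis using 4 by (simp add: relu_slope_def)
  qed
qed

text \<open>The product rule in each unit. At \<open>t = 0\<close> the second-order term, in which both \<open>u\<^sub>k\<close> and
  \<open>w\<^sub>k\<close> are perturbed, vanishes; this is what decouples the two blocks of a unit.\<close>

lemma network_has_right_derivative:
  fixes p d :: "(real \<times> (real^'d))^'h"
  shows "((\<lambda>t. network (p + t *\<^sub>R d) v) has_real_derivative
     (\<Sum>k\<in>UNIV. fst (d $ k) * max (snd (p $ k) \<bullet> v) 0
        + fst (p $ k) * relu_slope (snd (p $ k) \<bullet> v) (snd (d $ k) \<bullet> v))) (at_right 0)"
proof -
  have "((\<lambda>t. (fst (p $ k) + t * fst (d $ k)) * max (snd (p $ k) \<bullet> v + t * (snd (d $ k) \<bullet> v)) 0)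
      has_real_derivative (fst (d $ k) * max (snd (p $ k) \<bullet> v) 0
        + fst (p $ k) * relu_slope (snd (p $ k) \<bullet> v) (snd (d $ k) \<bullet> v))) (at_right 0)" for k
    by (rule DERIV_cong, rule DERIV_mult[OF _ relu_has_right_derivative])
       (auto intro!: derivative_eq_intros)
  then show ?thesis
    unfolding network_def
    by (auto intro!: DERIV_sum simp: inner_add_left)
qed

lemma GDERIV_imp_partial_derivative:
  fixes l :: "real \<times> real \<Rightarrow> real"
  assumes "GDERIV l (a, b) :> g"
  shows "((\<lambda>a. l (a, b)) has_real_derivative deriv (\<lambda>a. l (a, b)) a) (at a)"
proof -
  have "((\<lambda>a. (a, b)) has_derivative (\<lambda>h. (h, 0))) (at a)"
    by (auto intro!: derivative_eq_intros)
  moreover have "(l has_derivative (\<lambda>h. h \<bullet> g)) (at (a, b))"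
    using assms by (simp add: gderiv_def)
  ultimately have "((\<lambda>a. l (a, b)) has_derivative (\<lambda>h. (h, 0) \<bullet> g)) (at a)"
    using has_derivative_compose by blast
  moreover have "(\<lambda>h. (h, 0) \<bullet> g) = (*) (fst g)"
    by (auto simp: inner_prod_def)
  ultimately have "((\<lambda>a. l (a, b)) has_real_derivative fst g) (at a)"
    by (simp add: has_field_derivative_def)
  then show ?thesis by (simp add: DERIV_imp_deriv)
qed

lemma dir_deriv_eqI:
  assumes "((\<lambda>t. f (z + t *\<^sub>R d)) has_real_derivative D) (at_right 0)"
  shows "dir_deriv f z d = D"
  unfolding dir_deriv_def
  by (rule tendsto_Lim) (use assms in \<open>simp_all add: has_field_derivative_iff\<close>)

text \<open>The directional derivative of the loss when only \<open>w\<^sub>k\<close> moves, in direction \<open>v\<close>.\<close>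

definition weight_slope ::
  "(real \<times> real \<Rightarrow> real) \<Rightarrow> ('n::finite \<Rightarrow> real^'d) \<Rightarrow> ('n \<Rightarrow> real) \<Rightarrow> (real \<times> (real^'d))^'h
     \<Rightarrow> 'h \<Rightarrow> real^'d \<Rightarrow> real"
where
  "weight_slope l x y p k v =
     (\<Sum>i\<in>UNIV. fst (p $ k) * rho l x y p i * relu_slope (snd (p $ k) \<bullet> x i) (v \<bullet> x i))"

text \<open>Smoothness of the outer function turns the kinks of the network into kinks of the loss
  weighted by \<open>rho\<close>. Since a smooth outer function composed with a right-differentiable curve is
  right-differentiable, the limit in \<open>dir_deriv\<close> exists, and \<open>Lim\<close> has its intended value.\<close>

lemma dir_deriv_loss:
  fixes p d :: "(real \<times> (real^'d))^'h"
  assumes "smooth_loclip_gradient l"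
  shows "dir_deriv (loss l x y) p d =
     (\<Sum>k\<in>UNIV. fst (d $ k) * (\<Sum>i\<in>UNIV. rho l x y p i * max (snd (p $ k) \<bullet> x i) 0)
        + weight_slope l x y p k (snd (d $ k)))"
proof -
  let ?D = "\<lambda>i k. fst (d $ k) * max (snd (p $ k) \<bullet> x i) 0
        + fst (p $ k) * relu_slope (snd (p $ k) \<bullet> x i) (snd (d $ k) \<bullet> x i)"
  obtain g where g: "\<And>z. GDERIV l z :> g z"
    using assms unfolding smooth_loclip_gradient_def by blast
  have "((\<lambda>t. l (network (p + t *\<^sub>R d) (x i), y i)) has_real_derivative
      rho l x y p i * (\<Sum>k\<in>UNIV. ?D i k)) (at_right 0)" for i
    using DERIV_chain2[of "\<lambda>a. l (a, y i)" "rho l x y p i" "\<lambda>t. network (p + t *\<^sub>R d) (x i)" 0,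
        OF _ network_has_right_derivative]
      GDERIV_imp_partial_derivative[OF g]
    by (simp add: rho_def)
  then have "dir_deriv (loss l x y) p d = (\<Sum>i\<in>UNIV. rho l x y p i * (\<Sum>k\<in>UNIV. ?D i k))"
    unfolding loss_def by (intro dir_deriv_eqI DERIV_sum)
  also have "\<dots> = (\<Sum>k\<in>UNIV. \<Sum>i\<in>UNIV. rho l x y p i * ?D i k)"
    unfolding sum_distrib_left by (rule sum.swap)
  also have "\<dots> = (\<Sum>k\<in>UNIV. fst (d $ k) * (\<Sum>i\<in>UNIV. rho l x y p i * max (snd (p $ k) \<bullet> x i) 0)
        + weight_slope l x y p k (snd (d $ k)))"
    unfolding weight_slope_def sum_distrib_left sum.distrib[symmetric]
    by (intro sum.cong refl) (simp add: algebra_simps)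
  finally show ?thesis .
qed

section \<open>The subdifferential as a product over the units\<close>

text \<open>Testing with directions supported on one block separates the blocks, because the other
  blocks then contribute \<open>D k 0 = 0\<close>.\<close>

lemma frechet_subdiff_blockwise:
  fixes f :: "('a::real_inner)^'h \<Rightarrow> real"
  assumes D: "\<And>d. dir_deriv f p d = (\<Sum>k\<in>UNIV. D k (d $ k))"
    and zero: "\<And>k. D k 0 = 0"
  shows "s \<in> frechet_subdiff f p \<longleftrightarrow> (\<forall>k e. s $ k \<bullet> e \<le> D k e)"
proof
  assume s: "s \<in> frechet_subdiff f p"
  have "s $ k \<bullet> e \<le> D k e" for k e
  proof -
    have "(\<Sum>j\<in>UNIV. D j (axis k e $ j)) = (\<Sum>j\<in>UNIV. if j = k then D k e else 0)"
      by (intro sum.cong refl) (auto simp: axis_def zero)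
    moreover have "s \<bullet> axis k e \<le> dir_deriv f p (axis k e)"
      using s by (simp add: frechet_subdiff_def)
    ultimately show ?thesis by (simp add: D inner_axis)
  qed
  then show "\<forall>k e. s $ k \<bullet> e \<le> D k e" by blast
next
  assume "\<forall>k e. s $ k \<bullet> e \<le> D k e"
  then show "s \<in> frechet_subdiff f p"
    by (auto simp: frechet_subdiff_def D inner_vec_def intro!: sum_mono)
qed

text \<open>Below a function that is linear in the first component only its own slope fits: the two
  directions \<open>(1, 0)\<close> and \<open>(-1, 0)\<close> bound it from both sides.\<close>

lemma pair_below_separable_iff:
  fixes g :: "'a::real_inner"
  assumes "M 0 = 0"
  shows "(\<forall>e. (c, g) \<bullet> e \<le> fst e * C + M (snd e)) \<longleftrightarrow> c = C \<and> (\<forall>v. g \<bullet> v \<le> M v)"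
proof
  assume *: "\<forall>e. (c, g) \<bullet> e \<le> fst e * C + M (snd e)"
  have "g \<bullet> v \<le> M v" for v
    using *[rule_format, of "(0, v)"] by (simp add: inner_prod_def)
  moreover have "c = C"
    using *[rule_format, of "(1, 0)"] *[rule_format, of "(- 1, 0)"] assms
    by (simp add: inner_prod_def)
  ultimately show "c = C \<and> (\<forall>v. g \<bullet> v \<le> M v)" by blast
qed (auto simp: inner_prod_def mult.commute)

lemma frechet_subdiff_loss_iff:
  fixes p :: "(real \<times> (real^'d))^'h"
  assumes "smooth_loclip_gradient l"
  shows "s \<in> frechet_subdiff (loss l x y) p \<longleftrightarrow>
     (\<forall>k. fst (s $ k) = (\<Sum>i\<in>UNIV. rho l x y p i * max (snd (p $ k) \<bullet> x i) 0)
        \<and> (\<forall>v. snd (s $ k) \<bullet> v \<le> weight_slope l x y p k v))"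
proof -
  have M0: "weight_slope l x y p k 0 = 0" for k
    by (simp add: weight_slope_def)
  let ?C = "\<lambda>k. \<Sum>i\<in>UNIV. rho l x y p i * max (snd (p $ k) \<bullet> x i) 0"
  have "s \<in> frechet_subdiff (loss l x y) p \<longleftrightarrow>
      (\<forall>k e. s $ k \<bullet> e \<le> fst e * ?C k + weight_slope l x y p k (snd e))"
    by (rule frechet_subdiff_blockwise[OF dir_deriv_loss[OF assms]]) (simp add: M0)
  also have "\<dots> \<longleftrightarrow> (\<forall>k. fst (s $ k) = ?C k \<and> (\<forall>v. snd (s $ k) \<bullet> v \<le> weight_slope l x y p k v))"
    by (subst pair_below_separable_iff[where M = "weight_slope l x y p k" for k, OF M0, symmetric]) simp
  finally show ?thesis .
qed

section \<open>Minorants of the weight slope and zonotopes\<close>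

text \<open>The three groups of data: a linear part away from the kinks, a convex part from the positive
  kinks, and a concave part from the negative ones.\<close>

lemma weight_slope_split:
  "weight_slope l x y p k v =
     (\<Sum>i \<in> UNIV - (I_plus l x y p k \<union> I_minus l x y p k).
        (fst (p $ k) * rho l x y p i * of_bool (snd (p $ k) \<bullet> x i > 0)) *\<^sub>R x i) \<bullet> v
     + (\<Sum>j \<in> I_plus l x y p k. (fst (p $ k) * rho l x y p j) * max (v \<bullet> x j) 0)
     + (\<Sum>j \<in> I_minus l x y p k. (fst (p $ k) * rho l x y p j) * max (v \<bullet> x j) 0)"
proof -
  let ?P = "I_plus l x y p k" and ?M = "I_minus l x y p k"
  let ?F = "\<lambda>i. fst (p $ k) * rho l x y p i * relu_slope (snd (p $ k) \<bullet> x i) (v \<bullet> x i)"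
  have "weight_slope l x y p k v = sum ?F (UNIV - (?P \<union> ?M)) + sum ?F (?P \<union> ?M)"
    unfolding weight_slope_def by (rule sum.subset_diff) auto
  also have "sum ?F (?P \<union> ?M) = sum ?F ?P + sum ?F ?M"
    by (rule sum.union_disjoint) (auto simp: I_plus_def I_minus_def)
  also have "sum ?F ?P = (\<Sum>j \<in> ?P. (fst (p $ k) * rho l x y p j) * max (v \<bullet> x j) 0)"
    by (intro sum.cong) (auto simp: I_plus_def relu_slope_def)
  also have "sum ?F ?M = (\<Sum>j \<in> ?M. (fst (p $ k) * rho l x y p j) * max (v \<bullet> x j) 0)"
    by (intro sum.cong) (auto simp: I_minus_def relu_slope_def)
  also have "sum ?F (UNIV - (?P \<union> ?M)) = (\<Sum>i \<in> UNIV - (?P \<union> ?M).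
        (fst (p $ k) * rho l x y p i * of_bool (snd (p $ k) \<bullet> x i > 0)) *\<^sub>R x i) \<bullet> v"
    unfolding inner_sum_left
    by (intro sum.cong) (auto simp: I_plus_def I_minus_def relu_slope_def inner_commute)
  finally show ?thesis by simp
qed

lemma compact_set_sum:
  fixes S :: "'i \<Rightarrow> 'a::real_normed_vector set"
  assumes "finite I" "\<And>i. i \<in> I \<Longrightarrow> compact (S i)"
  shows "compact (\<Sum>i\<in>I. S i)"
  using assms
proof (induction I rule: finite_induct)
  case (insert i I)
  then have "compact {a + b | a b. a \<in> S i \<and> b \<in> (\<Sum>i\<in>I. S i)}"
    by (intro compact_sums) auto
  moreover have "{a + b | a b. a \<in> S i \<and> b \<in> (\<Sum>i\<in>I. S i)} = S i + (\<Sum>i\<in>I. S i)"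
    by (auto simp: set_plus_def)
  ultimately show ?case using insert by simp
qed (simp add: set_zero)

text \<open>The function on the right is the support function of the zonotope spanned by the segments
  \<open>[0, z\<^sub>i]\<close>, and a compact convex set is determined by its support function.\<close>

lemma mem_zonotope_iff:
  fixes z :: "'i \<Rightarrow> 'a::euclidean_space"
  assumes "finite I"
  shows "g \<in> (\<Sum>i\<in>I. (\<lambda>t. t *\<^sub>R z i) ` {0..1}) \<longleftrightarrow> (\<forall>v. g \<bullet> v \<le> (\<Sum>i\<in>I. max (v \<bullet> z i) 0))"
    (is "g \<in> ?Z \<longleftrightarrow> _")
proof
  assume "g \<in> ?Z"
  then obtain s where g: "g = sum s I" and s: "\<forall>i\<in>I. s i \<in> (\<lambda>t. t *\<^sub>R z i) ` {0..1}"
    unfolding set_sum_alt[OF assms] by blast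
  have "s i \<bullet> v \<le> max (v \<bullet> z i) 0" if i: "i \<in> I" for i v
  proof -
    obtain t where t: "0 \<le> t" "t \<le> 1" "s i = t *\<^sub>R z i"
      using bspec[OF s i] by auto
    have "t * (v \<bullet> z i) \<le> t * max (v \<bullet> z i) 0"
      using t by (intro mult_left_mono) auto
    also have "\<dots> \<le> max (v \<bullet> z i) 0"
      using t by (simp add: mult_left_le_one_le)
    finally show ?thesis by (simp add: t inner_commute)
  qed
  then show "\<forall>v. g \<bullet> v \<le> (\<Sum>i\<in>I. max (v \<bullet> z i) 0)"
    by (simp add: g inner_sum_left sum_mono)
next
  assume below: "\<forall>v. g \<bullet> v \<le> (\<Sum>i\<in>I. max (v \<bullet> z i) 0)"
  show "g \<in> ?Z"
  proof (rule ccontr)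
    assume "g \<notin> ?Z"
    have "convex ?Z"
      by (intro convex_set_sum convex_linear_image) (auto intro!: linearI simp: algebra_simps)
    moreover have "closed ?Z"
      by (intro compact_imp_closed compact_set_sum assms compact_continuous_image)
         (auto intro!: continuous_intros)
    ultimately obtain v b where v: "v \<bullet> g < b" "\<forall>w\<in>?Z. b < v \<bullet> w"
      using separating_hyperplane_closed_point[of ?Z g] \<open>g \<notin> ?Z\<close> by blast
    \<comment> \<open>This vertex of the zonotope maximizes the inner product with \<open>- v\<close>.\<close>
    let ?s = "\<lambda>i. (if - v \<bullet> z i > 0 then 1 else 0) *\<^sub>R z i"
    have "sum ?s I \<in> ?Z"
      unfolding set_sum_alt[OF assms] by (auto intro!: exI[of _ ?s])
    moreover have "(- v) \<bullet> sum ?s I = (\<Sum>i\<in>I. max ((- v) \<bullet> z i) 0)"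
      unfolding inner_sum_right by (intro sum.cong) auto
    ultimately show False
      using v below[rule_format, of "- v"] by (force simp: inner_commute)
  qed
qed

text \<open>Without negative kinks, \<open>G_F\<close> is a zonotope translated by the linear part. The segments are
  generated by \<open>u\<^sub>k * \<rho>\<^sub>j\<close> times \<open>x\<^sub>j\<close>; as the factor is nonnegative on \<open>I_plus\<close>, it can be pulled
  out of the maximum in the support function.\<close>

lemma G_F_iff_below_weight_slope:
  assumes "I_minus l x y p k = {}"
  shows "g \<in> G_F l x y p k \<longleftrightarrow> (\<forall>v. g \<bullet> v \<le> weight_slope l x y p k v)"
proof -
  define A where "A = (\<Sum>i \<in> UNIV - (I_plus l x y p k \<union> I_minus l x y p k).
        (fst (p $ k) * rho l x y p i * of_bool (snd (p $ k) \<bullet> x i > 0)) *\<^sub>R x i)"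
  let ?z = "\<lambda>j. (fst (p $ k) * rho l x y p j) *\<^sub>R x j"
  define Z where "Z = (\<Sum>j \<in> I_plus l x y p k. (\<lambda>t. t *\<^sub>R ?z j) ` {0..1})"
  have "(\<Sum>j \<in> I_plus l x y p k. max (v \<bullet> ?z j) 0)
      = (\<Sum>j \<in> I_plus l x y p k. (fst (p $ k) * rho l x y p j) * max (v \<bullet> x j) 0)" for v
    by (intro sum.cong) (auto simp: I_plus_def max_mult_distrib_left)
  then have slope: "weight_slope l x y p k v = A \<bullet> v + (\<Sum>j \<in> I_plus l x y p k. max (v \<bullet> ?z j) 0)" for v
    unfolding weight_slope_split A_def using assms by simp
  have "G_F l x y p k = {A} + Z + {0}"
    unfolding G_F_def A_def[symmetric] Z_def[symmetric] by (simp add: assms)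
  then have "g \<in> G_F l x y p k \<longleftrightarrow> g - A \<in> Z"
    by (auto simp: set_plus_def intro!: bexI[of _ "g - A"])
  also have "\<dots> \<longleftrightarrow> (\<forall>v. g \<bullet> v \<le> weight_slope l x y p k v)"
    unfolding Z_def by (subst mem_zonotope_iff) (auto simp: slope inner_diff_left algebra_simps)
  finally show ?thesis .
qed

section \<open>Negative kinks and the span qualification\<close>

text \<open>If \<open>x\<^sub>j\<close> were outside the span of the positive kinks, its component \<open>v\<close> orthogonal to that
  span would give a line along which the convex part of the slope vanishes. Adding the bounds for
  \<open>v\<close> and \<open>- v\<close> cancels the linear terms and leaves a negative multiple of \<open>\<bar>v \<bullet> x\<^sub>j\<bar>\<close>, together
  with other nonpositive terms, bounded below by \<open>0\<close>.\<close>

lemma I_minus_in_span_I_plus_if_slope_minorized: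
  fixes x :: "'n::finite \<Rightarrow> real^'d"
  assumes minor: "\<And>v. g \<bullet> v \<le> weight_slope l x y p k v"
    and j: "j \<in> I_minus l x y p k"
  shows "x j \<in> span (x ` I_plus l x y p k)"
proof (rule ccontr)
  let ?P = "I_plus l x y p k" and ?M = "I_minus l x y p k"
  assume "x j \<notin> span (x ` ?P)"
  obtain q v where q: "q \<in> span (x ` ?P)" and orth: "\<And>w. w \<in> span (x ` ?P) \<Longrightarrow> orthogonal v w"
    and dec: "x j = q + v"
    by (rule orthogonal_subspace_decomp_exists[of "x ` ?P" "x j"]) (rule that)
  have "v \<noteq> 0" using dec q \<open>x j \<notin> _\<close> by auto
  then have vj: "v \<bullet> x j \<noteq> 0"
    using orth[OF q] by (simp add: dec inner_add_right orthogonal_def)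
  have plus: "v \<bullet> x i = 0" if "i \<in> ?P" for i
    using orth[OF span_base, of "x i"] that by (simp add: orthogonal_def)
  let ?b = "\<lambda>i. fst (p $ k) * rho l x y p i"
  have "0 \<le> weight_slope l x y p k v + weight_slope l x y p k (- v)"
    using minor[of v] minor[of "- v"] by simp
  also have "\<dots> = (\<Sum>i\<in>?M. ?b i * max (v \<bullet> x i) 0) + (\<Sum>i\<in>?M. ?b i * max (- v \<bullet> x i) 0)"
    unfolding weight_slope_split by (simp add: plus)
  also have "\<dots> = (\<Sum>i\<in>?M. ?b i * \<bar>v \<bullet> x i\<bar>)"
    unfolding sum.distrib[symmetric] by (intro sum.cong) (auto simp: max_def)
  also have "\<dots> < (\<Sum>i\<in>?M. 0)"
  proof (rule sum_strict_mono_ex1)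
    show "\<exists>i\<in>?M. ?b i * \<bar>v \<bullet> x i\<bar> < 0"
      using j vj by (intro bexI[of _ j]) (auto simp: I_minus_def mult_neg_pos)
  qed (auto simp: I_minus_def mult_nonpos_nonneg)
  finally show False by simp
qed

theorem theorem17:
  fixes l :: "real \<times> real \<Rightarrow> real"
    and x :: "'n::finite \<Rightarrow> real^'d"
    and y :: "'n \<Rightarrow> real"
    and p :: "(real \<times> (real^'d))^'h"
  assumes "smooth_loclip_gradient l"
    and "\<And>i. x i \<noteq> 0"
    and "frechet_subdiff (loss l x y) p \<noteq> {}"
  shows "frechet_subdiff (loss l x y) p =
           {s. \<forall>k. s $ k \<in> {\<Sum>i\<in>UNIV. rho l x y p i * max (snd (p $ k) \<bullet> x i) 0} \<times> G_F l x y p k}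
         \<longleftrightarrow> span_qualification l x y p"
    (is "?S = ?R \<longleftrightarrow> _")
proof -
  obtain s where s: "s \<in> ?S" using assms(3) by blast
  have chain: "?S = ?R \<longleftrightarrow> (\<forall>k. I_minus l x y p k = {})"
  proof
    assume "?S = ?R"
    with s have "G_F l x y p k \<noteq> {}" for k by (auto simp: mem_Times_iff)
    then show "\<forall>k. I_minus l x y p k = {}"
      by (force simp: G_F_def set_plus_def card_gt_0_iff split: if_splits)
  next
    assume "\<forall>k. I_minus l x y p k = {}"
    then show "?S = ?R"
      by (auto simp: frechet_subdiff_loss_iff[OF assms(1)] G_F_iff_below_weight_slope mem_Times_iff)
  qed
  have "span_qualification l x y p \<longleftrightarrow> (\<forall>k. I_minus l x y p k = {})"
  proof
    assume sq: "span_qualification l x y p"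
    have "j \<notin> I_minus l x y p k" for j k
    proof
      assume j: "j \<in> I_minus l x y p k"
      then have "x j \<in> span (x ` I_plus l x y p k)"
        using s by (intro I_minus_in_span_I_plus_if_slope_minorized[of "snd (s $ k)"])
          (simp_all add: frechet_subdiff_loss_iff[OF assms(1)])
      moreover have "x j \<in> span (x ` I_minus l x y p k)"
        using j by (simp add: span_base)
      ultimately show False
        using sq assms(2)[of j] unfolding span_qualification_def by blast
    qed
    then show "\<forall>k. I_minus l x y p k = {}" by blast
  next
    assume "\<forall>k. I_minus l x y p k = {}"
    then show "span_qualification l x y p"
      by (auto simp: span_qualification_def span_zero)
  qed
  with chain show ?thesis by simp
qed

end
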